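(* Let $f:\mathbb{Z}^2\to\mathbb{R}$ be a function vanishing at infinity and let $f^*:\mathbb{Z}^2\to\mathbb{R}_{\ge 0}$ denote the spiral rearrangement of $f$. Then, for all $1\le p\le\infty$, $$\|\nabla f^*\|_{p}\le 4^{1+1/p}\,\|\nabla f\|_{p},$$ where $1/\infty:=0$ and the inequality is understood in $[0,\infty]$.
   Context: $\mathbb{Z}^2$ carries the standard lattice graph structure: $x\sim y$ if and only if $\|x-y\|_{\ell^1}=1$. For $g:\mathbb{Z}^2\to\mathbb{R}$ and $1\le p<\infty$, $\|\nabla g\|_p^p=\sum_{x\sim y}|g(x)-g(y)|^p$ (the sum runs once over each undirected edge), and $\|\nabla g\|_\infty=\sup_{x\sim y}|g(x)-g(y)|$. A function $f$ vanishes at infinity if $\{x:|f(x)|>t\}$ is finite for every $t>0$. Given a bijection $\eta:\{1,2,3,\dots\}\to\mathbb{Z}^2$ (a labelling), the associated rearrangement $f^*$ of $f$ is defined by $f^*(\eta(k)):=$ the $k$-th largest value assumed by $|f|$, counted with multiplicity (that is, the largest $t\ge 0$ such that $|f(x)|\ge t$ for at least $k$ points $x$). The spiral labelling $\eta$ of $\mathbb{Z}^2$ is the square spiral starting at $\eta(1)=(0,0)$ in which consecutive labels are obtained by unit steps: 1 step right, 1 step up, 2 steps left, 2 steps down, 3 steps right, 3 steps up, 4 steps left, 4 steps down, and so on. Thus $\eta(1),\eta(2),\dots$ are $(0,0),(1,0),(1,1),(0,1),(-1,1),(-1,0),(-1,-1),(0,-1),(1,-1),(2,-1),(2,0),(2,1),(2,2),(1,2),(0,2),(-1,2),\dots$.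 The spiral rearrangement is the rearrangement associated with this labelling. *)

theory Defs
  imports "HOL-Analysis.Analysis"
begin

type_synonym lattice = "int \<times> int"

definition adjacent :: "lattice \<Rightarrow> lattice \<Rightarrow> bool" where
  "adjacent x y \<longleftrightarrow> \<bar>fst x - fst y\<bar> + \<bar>snd x - snd y\<bar> = 1"

definition edges :: "lattice set set" where
  "edges = {{x, y} | x y. adjacent x y}"

definition edge_diff :: "(lattice \<Rightarrow> real) \<Rightarrow> lattice set \<Rightarrow> real" where
  "edge_diff g e = (THE d. \<exists>x y. e = {x, y} \<and> d = \<bar>g x - g y\<bar>)"

lemma edge_diff_doubleton [simp]: "edge_diff g {x, y} = \<bar>g x - g y\<bar>"
  unfolding edge_diff_def
proof (rule the_equality)
  show "\<exists>x' y'. {x, y} = {x', y'} \<and> \<bar>g x - g y\<bar> = \<bar>g x' - g y'\<bar>"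
    by blast
next
  fix d
  assume "\<exists>x' y'. {x, y} = {x', y'} \<and> d = \<bar>g x' - g y'\<bar>"
  then show "d = \<bar>g x - g y\<bar>"
    by (metis abs_minus_commute doubleton_eq_iff)
qed

text \<open>Both the exponent and the value range over the extended nonnegative reals.\<close>

definition grad_norm :: "ennreal \<Rightarrow> (lattice \<Rightarrow> real) \<Rightarrow> ennreal" where
  "grad_norm p g =
     (if p = \<infinity> then (SUP e\<in>edges. ennreal (edge_diff g e))
      else let S = (\<Sum>\<^sub>\<infinity>e\<in>edges. ennreal (edge_diff g e powr enn2real p)) in
        if S = \<infinity> then \<infinity> else ennreal (enn2real S powr (1 / enn2real p)))"

definition vanishes_at_infinity :: "(lattice \<Rightarrow> real) \<Rightarrow> bool" where
  "vanishes_at_infinity f \<longleftrightarrow> (\<forall>t>0. finite {x. \<bar>f x\<bar> > t})"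

text \<open>The superlevel set may be infinite (e.g. for \<open>t = 0\<close>), where \<^const>\<open>card\<close> is \<open>0\<close>;
  hence the formulation through a finite subset with exactly \<open>k\<close> elements.\<close>

definition kth_largest :: "(lattice \<Rightarrow> real) \<Rightarrow> nat \<Rightarrow> real" where
  "kth_largest f k =
     (GREATEST t. 0 \<le> t \<and> (\<exists>A. finite A \<and> card A = k \<and> (\<forall>x\<in>A. \<bar>f x\<bar> \<ge> t)))"

text \<open>Labels start at \<open>1\<close>; a labelling \<open>\<eta>\<close> is a bijection from \<open>{1..}\<close> onto the lattice.\<close>

definition rearrangement ::
    "(nat \<Rightarrow> lattice) \<Rightarrow> (lattice \<Rightarrow> real) \<Rightarrow> lattice \<Rightarrow> real" where
  "rearrangement \<eta> f x = kth_largest f (inv_into {1..} \<eta> x)"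

text \<open>The square spiral is a concatenation of straight runs \<open>j = 0, 1, 2, \<dots>\<close>: run \<open>j\<close> has
  \<open>j div 2 + 1\<close> unit steps, and the directions cycle through right, up, left, down.
  Steps are numbered from \<open>0\<close>, so that step \<open>n\<close> leads from label \<open>n + 1\<close> to label \<open>n + 2\<close>.\<close>

definition run_of_step :: "nat \<Rightarrow> nat" where
  "run_of_step n = (LEAST j. n < (\<Sum>i\<le>j. i div 2 + 1))"

definition run_direction :: "nat \<Rightarrow> lattice" where
  "run_direction j = [(1, 0), (0, 1), (-1, 0), (0, -1)] ! (j mod 4)"

definition spiral :: "nat \<Rightarrow> lattice" where
  "spiral k = (\<Sum>n<k - 1. run_direction (run_of_step n))"

abbreviation spiral_rearrangement :: "(lattice \<Rightarrow> real) \<Rightarrow> lattice \<Rightarrow> real" where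
  "spiral_rearrangement \<equiv> rearrangement spiral"

end

theory Submission
  imports Defs
begin

text \<open>
  Let \<open>v 1 \<ge> v 2 \<ge> \<dots>\<close> be the values of \<open>\<bar>f\<bar>\<close> in decreasing order, so that \<open>f\<^sup>*\<close> has the value \<open>v k\<close> at
  the point with label \<open>k\<close>. Cut the labels at the breakpoints \<open>K i = 1 + i (i + 1) / 2\<close> and let
  \<open>d i = v (K i) - v (K (i + 1))\<close> be the drop of the values across the \<open>i\<close>-th block. For finite \<open>p\<close>,
  both gradient norms are compared with the weighted sum \<open>W = (\<Sum>i. (5 i + 11) d i ^ p)\<close>.

  For \<open>f\<close>: pick \<open>K i\<close> points where \<open>\<bar>f\<bar> \<ge> v (K i)\<close>. Counting the two ends of every occupied row or
  column, this set has at least \<open>2 sqrt (K i)\<close> outer boundary points, and if \<open>d i > 0\<close>, at most \<open>i\<close> of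
  them can have \<open>\<bar>f\<bar> > v (K (i + 1))\<close>. So at least \<open>2 sqrt (K i) - i \<ge> (5 i + 11) / 16\<close> edges see the
  full drop \<open>d i\<close> (\<open>many_spanning_edges\<close>). An edge may span several blocks, but \<open>t \<mapsto> t ^ p\<close> is
  superadditive, whence \<open>W \<le> 16 \<parallel>\<nabla>f\<parallel> ^ p\<close> (\<open>weighted_drops_le\<close>).

  For \<open>f\<^sup>*\<close>: the labels of two neighbours differ by about \<open>4 sqrt k\<close> at most, \<open>k\<close> being the smaller one,
  which is less than the length of three consecutive blocks near \<open>k\<close>. Hence an edge whose larger label lies in
  block \<open>i\<close> has difference at most \<open>d (i - 3) + \<dots> + d i\<close>, and convexity bounds the \<open>p\<close>-th power of
  this sum by \<open>4 ^ (p - 1)\<close> times the sum of the \<open>p\<close>-th powers. Each label is the larger label of at most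
  two edges: one to its predecessor, which only sees \<open>d i\<close>, and one leading back by about one
  full turn of the spiral. As block \<open>i\<close> has \<open>i + 1\<close> labels, \<open>d m ^ p\<close> is used with total weight at most
  \<open>4 ^ (p - 1) ((m + 1) + (4 m + 10))\<close>, whence \<open>\<parallel>\<nabla>f\<^sup>*\<parallel> ^ p \<le> 4 ^ (p - 1) W\<close>
  (\<open>finite_edge_sum_le_drops\<close>).

  Together, \<open>\<parallel>\<nabla>f\<^sup>*\<parallel> ^ p \<le> 4 ^ (p + 1) \<parallel>\<nabla>f\<parallel> ^ p\<close>. For \<open>p = \<infinity>\<close>, a difference of \<open>f\<^sup>*\<close> is a sum of at most
  four drops, each of which is seen by some edge of \<open>f\<close>.
\<close>

section \<open>A closed formula for the labels of the spiral\<close>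

definition maxnorm :: "lattice \<Rightarrow> int" where
  "maxnorm z = max \<bar>fst z\<bar> \<bar>snd z\<bar>"

definition spiral_label :: "lattice \<Rightarrow> int" where
  "spiral_label z = (let x = fst z; y = snd z; n = maxnorm z in
     if y = - n then 4 * n\<^sup>2 + 3 * n + 1 + x
     else if x = n then 4 * n\<^sup>2 - 3 * n + 1 + y
     else if y = n then 4 * n\<^sup>2 - n + 1 - x
     else 4 * n\<^sup>2 + n + 1 - y)"

text \<open>One step towards the inside, perpendicular to the side of the square on which the point lies. Corners
  may count for either side, except for \<open>(n, -n)\<close>, where a winding ends: counted for the bottom side, it
  is sent to \<open>(n, 1 - n)\<close>, where the same winding began.\<close>

definition inward :: "lattice \<Rightarrow> lattice" where
  "inward z = (let x = fst z; y = snd z; n = maxnorm z in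
     if y = - n then (x, y + 1)
     else if x = n then (x - 1, y)
     else if y = n then (x, y - 1)
     else (x + 1, y))"

text \<open>The points of sup-norm \<open>n\<close> fill the labels between two consecutive odd squares; this separates the
  windings.\<close>

lemma spiral_label_bounds:
  "(2 * maxnorm z - 1)\<^sup>2 < spiral_label z \<or> maxnorm z = 0"
  "spiral_label z \<le> (2 * maxnorm z + 1)\<^sup>2"
  unfolding spiral_label_def Let_def maxnorm_def power2_eq_square
  by (auto simp: algebra_simps max_def split: if_splits)

lemma spiral_label_ge_1: "1 \<le> spiral_label z"
proof (cases "maxnorm z = 0")
  case True
  then show ?thesis unfolding spiral_label_def Let_def by (auto simp: maxnorm_def max_def split: if_splits)
next
  case False
  then show ?thesis using spiral_label_bounds(1)[of z] zero_le_power2[of "2 * maxnorm z - 1"] by linarith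
qed

text \<open>Normal form for the case analyses below: within one side the label is linear in the coordinates and in
  \<open>n\<close>, apart from the common term \<open>4 n\<^sup>2\<close>, so that the remaining goals are linear.\<close>

lemma spiral_label_sides:
  obtains "snd z = - maxnorm z" "- maxnorm z \<le> fst z" "fst z \<le> maxnorm z"
      "spiral_label z = 4 * (maxnorm z)\<^sup>2 + 3 * maxnorm z + 1 + fst z" "inward z = (fst z, snd z + 1)"
  | "fst z = maxnorm z" "- maxnorm z < snd z" "snd z \<le> maxnorm z"
      "spiral_label z = 4 * (maxnorm z)\<^sup>2 - 3 * maxnorm z + 1 + snd z" "inward z = (fst z - 1, snd z)"
  | "snd z = maxnorm z" "- maxnorm z \<le> fst z" "fst z < maxnorm z"
      "spiral_label z = 4 * (maxnorm z)\<^sup>2 - maxnorm z + 1 - fst z" "inward z = (fst z, snd z - 1)"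
  | "fst z = - maxnorm z" "- maxnorm z < snd z" "snd z < maxnorm z"
      "spiral_label z = 4 * (maxnorm z)\<^sup>2 + maxnorm z + 1 - snd z" "inward z = (fst z + 1, snd z)"
proof -
  define n where "n = maxnorm z"
  have b: "- n \<le> fst z" "fst z \<le> n" "- n \<le> snd z" "snd z \<le> n"
    and e: "snd z = - n \<or> fst z = n \<or> snd z = n \<or> fst z = - n"
    unfolding n_def maxnorm_def by linarith+
  then consider "snd z = - n" | "fst z = n" "snd z \<noteq> - n" 
     | "snd z = n" "fst z \<noteq> n" "snd z \<noteq> - n" | "fst z = - n" "snd z \<noteq> - n" "snd z \<noteq> n" "fst z \<noteq> n" by blast
  then show thesis
    using that b unfolding spiral_label_def inward_def Let_def n_def[symmetric] by cases auto
qed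

lemma inj_spiral_label: "inj spiral_label"
proof (rule injI)
  fix z w assume eq: "spiral_label z = spiral_label w"
  have le: "maxnorm u \<le> maxnorm u'" if "spiral_label u = spiral_label u'" for u u'
  proof (rule ccontr)
    assume "\<not> maxnorm u \<le> maxnorm u'"
    then have r: "2 * maxnorm u' + 1 \<le> 2 * maxnorm u - 1" "0 \<le> maxnorm u'" "maxnorm u \<noteq> 0"
      by (linarith, auto simp: maxnorm_def)
    then have "(2 * maxnorm u' + 1)\<^sup>2 \<le> (2 * maxnorm u - 1)\<^sup>2" by (intro power_mono) auto
    then show False using spiral_label_bounds(1)[of u] spiral_label_bounds(2)[of u'] that r by linarith
  qed
  have "maxnorm z = maxnorm w" using le eq by (metis order_antisym)
  then have "fst z = fst w \<and> snd z = snd w"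
    using eq by (cases rule: spiral_label_sides[of z]; cases rule: spiral_label_sides[of w]; simp; linarith)
  then show "z = w" by (simp add: prod_eq_iff)
qed

lemma adjacent_iff:
  "adjacent z w \<longleftrightarrow> fst z = fst w + 1 \<and> snd z = snd w \<or> fst z = fst w - 1 \<and> snd z = snd w \<or>
     fst z = fst w \<and> snd z = snd w + 1 \<or> fst z = fst w \<and> snd z = snd w - 1"
  unfolding adjacent_def by linarith

text \<open>The squares are listed along with the norms so that they can serve as linear atoms.\<close>

lemma maxnorm_adjacent:
  assumes "adjacent z w"
  shows "maxnorm w = maxnorm z \<and> (maxnorm w)\<^sup>2 = (maxnorm z)\<^sup>2 \<or>
    maxnorm w = maxnorm z + 1 \<and> (maxnorm w)\<^sup>2 = (maxnorm z)\<^sup>2 + 2 * maxnorm z + 1 \<or>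
    maxnorm w = maxnorm z - 1 \<and> (maxnorm w)\<^sup>2 = (maxnorm z)\<^sup>2 - 2 * maxnorm z + 1"
proof -
  have "maxnorm w = maxnorm z \<or> maxnorm w = maxnorm z + 1 \<or> maxnorm w = maxnorm z - 1"
    using assms unfolding adjacent_def maxnorm_def by linarith
  then show ?thesis by (elim disjE; simp; simp add: power2_eq_square algebra_simps)
qed

section \<open>Neighbours with smaller labels\<close>

text \<open>The four sides as one premise, for the endpoint of an edge that is not split into cases.\<close>

lemma spiral_label_on_sides:
  "snd z = - maxnorm z \<and> - maxnorm z \<le> fst z \<and> fst z \<le> maxnorm z \<and>
      spiral_label z = 4 * (maxnorm z)\<^sup>2 + 3 * maxnorm z + 1 + fst z \<or>
   fst z = maxnorm z \<and> - maxnorm z < snd z \<and> snd z \<le> maxnorm z \<and>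
      spiral_label z = 4 * (maxnorm z)\<^sup>2 - 3 * maxnorm z + 1 + snd z \<or>
   snd z = maxnorm z \<and> - maxnorm z \<le> fst z \<and> fst z < maxnorm z \<and>
      spiral_label z = 4 * (maxnorm z)\<^sup>2 - maxnorm z + 1 - fst z \<or>
   fst z = - maxnorm z \<and> - maxnorm z < snd z \<and> snd z < maxnorm z \<and>
      spiral_label z = 4 * (maxnorm z)\<^sup>2 + maxnorm z + 1 - snd z"
  by (rule spiral_label_sides[of z]) simp_all

text \<open>A typical point has its successor, its predecessor, one neighbour on the next winding, and the inward
  neighbour. At corners and at the first point of a winding, where some of these roles coincide, every
  further neighbour has a larger label.\<close>

lemma lower_neighbour:
  assumes adj: "adjacent z w" and less: "spiral_label z < spiral_label w"
  shows "spiral_label z = spiral_label w - 1 \<or> z = inward w"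
proof -
  note rings = maxnorm_adjacent[OF adj] and adj = adj[unfolded adjacent_iff] and zs = spiral_label_on_sides[of z]
  have "spiral_label z = spiral_label w - 1 \<or> fst z = fst (inward w) \<and> snd z = snd (inward w)"
  proof (cases rule: spiral_label_sides[of w])
    case 1
    then show ?thesis using less rings adj zs unfolding 1(5) fst_conv snd_conv by (smt (z3))
  next
    case 2
    then show ?thesis using less rings adj zs unfolding 2(5) fst_conv snd_conv by (smt (z3))
  next
    case 3
    then show ?thesis using less rings adj zs unfolding 3(5) fst_conv snd_conv by (smt (z3))
  next
    case 4
    then show ?thesis using less rings adj zs unfolding 4(5) fst_conv snd_conv by (smt (z3))
  qed
  then show ?thesis by (simp add: prod_eq_iff)
qed

text \<open>One winding through the label \<open>k\<close> has length about \<open>4 sqrt k\<close>. The form \<open>(gap - 5)\<^sup>2 \<le> 16 k\<close> is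
  sharp enough for the breakpoints chosen later: unless \<open>z\<close> is the predecessor of \<open>w\<close>, on
  each side of the square the gap and a lower bound for \<open>k\<close> are explicit polynomials in the sup-norm
  of \<open>w\<close>.\<close>

lemma lower_neighbour_gap:
  assumes adj: "adjacent z w" and less: "spiral_label z < spiral_label w"
  shows "(spiral_label w - spiral_label z - 5)\<^sup>2 \<le> 16 * spiral_label z"
proof (cases "spiral_label z = spiral_label w - 1")
  case True
  then show ?thesis using spiral_label_ge_1[of z] by simp
next
  case False
  define L where "L = spiral_label z"
  define D where "D = spiral_label w - L"
  define m where "m = maxnorm w"
  have inw: "z = inward w" using lower_neighbour[OF assms] False by simp
  note rings = maxnorm_adjacent[OF adj] and zs = spiral_label_on_sides[of z]
  have D: "1 < D" using less False by (simp add: D_def L_def)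
  have "(D - 5)\<^sup>2 \<le> 16 * L"
  proof (cases rule: spiral_label_sides[of w])
    case 1
    have "fst z = fst w" "snd z = snd w + 1" using 1(5) inw by simp_all
    then have "D = 8 * m - 1 \<and> 4 * m\<^sup>2 - 6 * m + 3 \<le> L"
      using 1(1-4) D rings zs unfolding D_def L_def m_def by (smt (z3))
    then show ?thesis by clarify (simp add: power2_eq_square algebra_simps)
  next
    case 2
    have "fst z = fst w - 1" "snd z = snd w" using 2(5) inw by simp_all
    then have "D = 8 * m - 7 \<and> 4 * m\<^sup>2 - 12 * m + 10 \<le> L"
      using 2(1-4) D rings zs unfolding D_def L_def m_def by (smt (z3))
    then show ?thesis by clarify (simp add: power2_eq_square algebra_simps)
  next
    case 3
    have "fst z = fst w" "snd z = snd w - 1" using 3(5) inw by simp_all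
    then have "D = 8 * m - 5 \<and> 4 * m\<^sup>2 - 10 * m + 7 \<le> L"
      using 3(1-4) D rings zs unfolding D_def L_def m_def by (smt (z3))
    then show ?thesis by clarify (simp add: power2_eq_square algebra_simps)
  next
    case 4
    have "fst z = fst w + 1" "snd z = snd w" using 4(5) inw by simp_all
    then have "D = 8 * m - 3 \<and> 4 * m\<^sup>2 - 8 * m + 5 \<le> L"
      using 4(1-4) D rings zs unfolding D_def L_def m_def by (smt (z3))
    then show ?thesis by clarify (simp add: power2_eq_square algebra_simps)
  qed
  then show ?thesis by (simp add: D_def L_def)
qed

section \<open>The formula inverts the spiral\<close>

text \<open>The corner at which run \<open>j\<close> begins has label \<open>run_start j + 1\<close>.\<close>

definition run_start :: "nat \<Rightarrow> nat" where
  "run_start j = (\<Sum>i<j. i div 2 + 1)"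

lemma run_start_even: "run_start (2 * m) = m * (m + 1)"
  by (induction m) (auto simp: run_start_def algebra_simps)

lemma run_start_Suc: "run_start (Suc j) = run_start j + (j div 2 + 1)"
  by (simp add: run_start_def)

lemma run_of_step_eq:
  assumes "run_start j \<le> n" "n < run_start (Suc j)"
  shows "run_of_step n = j"
  unfolding run_of_step_def
proof (rule Least_equality)
  show "n < (\<Sum>i\<le>j. i div 2 + 1)"
    using assms(2) by (simp add: run_start_def lessThan_Suc_atMost)
next
  fix k assume "n < (\<Sum>i\<le>k. i div 2 + 1)"
  then have k: "n < run_start (Suc k)" by (simp add: run_start_def lessThan_Suc_atMost)
  show "j \<le> k"
  proof (rule ccontr)
    assume "\<not> j \<le> k"
    then have "run_start (Suc k) \<le> run_start j"
      unfolding run_start_def by (intro sum_mono2) auto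
    then show False using k assms(1) by simp
  qed
qed

lemma run_exists: "\<exists>j. run_start j \<le> n \<and> n < run_start (Suc j)"
proof (induction n)
  case 0
  show ?case by (rule exI[of _ 0]) (simp add: run_start_def)
next
  case (Suc n)
  then obtain j where j: "run_start j \<le> n" "n < run_start (Suc j)" by blast
  show ?case
  proof (cases "Suc n < run_start (Suc j)")
    case True
    then show ?thesis using j by (intro exI[of _ j]) auto
  next
    case False
    then show ?thesis using j by (intro exI[of _ "Suc j"]) (auto simp: run_start_Suc)
  qed
qed

lemma spiral_along_run:
  assumes "s \<le> j div 2 + 1"
  shows "spiral (run_start j + s + 1) = 
    (fst (spiral (run_start j + 1)) + int s * fst (run_direction j), snd (spiral (run_start j + 1)) + int s * snd (run_direction j))"
  using assms
proof (induction s)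
  case 0
  then show ?case by simp
next
  case (Suc s)
  have "run_of_step (run_start j + s) = j"
    using Suc.prems by (intro run_of_step_eq) (auto simp: run_start_Suc)
  then show ?case using Suc by (simp add: spiral_def algebra_simps plus_prod_def)
qed

lemma run_direction_4: 
  "run_direction (4 * q) = (1, 0)" "run_direction (4 * q + 1) = (0, 1)"
  "run_direction (4 * q + 2) = (-1, 0)" "run_direction (4 * q + 3) = (0, -1)"
proof -
  have "(4 * q + 1) mod 4 = 1" "(4 * q + 2) mod 4 = 2" "(4 * q + 3) mod 4 = 3" by presburger+
  then show "run_direction (4 * q) = (1, 0)" "run_direction (4 * q + 1) = (0, 1)"
    "run_direction (4 * q + 2) = (-1, 0)" "run_direction (4 * q + 3) = (0, -1)"
    by (simp_all add: run_direction_def)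
qed

lemma spiral_next_corner:
  "spiral (run_start (Suc j) + 1) = 
    (fst (spiral (run_start j + 1)) + int (j div 2 + 1) * fst (run_direction j),
     snd (spiral (run_start j + 1)) + int (j div 2 + 1) * snd (run_direction j))"
  using spiral_along_run[of "j div 2 + 1" j] by (simp add: run_start_Suc add.assoc)

lemma div2_4: "4 * q div 2 = 2 * q" "(4 * q + 1) div 2 = 2 * q" "(4 * q + 2) div 2 = 2 * q + 1" "(4 * q + 3) div 2 = 2 * q + 1" 
  for q :: nat by presburger+

lemma Suc_4: "Suc (4 * q) = 4 * q + 1" "Suc (4 * q + 1) = 4 * q + 2" "Suc (4 * q + 2) = 4 * q + 3" "Suc (4 * q + 3) = 4 * q + 4"
  by simp_all

text \<open>Four runs lead from \<open>(-q, -q)\<close> to \<open>(-(q + 1), -(q + 1))\<close>; the corners in between are the three other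
  formulas.\<close>

lemma spiral_corners:
  shows "spiral (run_start (4 * q) + 1) = (- int q, - int q)"
    and "spiral (run_start (4 * q + 1) + 1) = (int q + 1, - int q)"
    and "spiral (run_start (4 * q + 2) + 1) = (int q + 1, int q + 1)"
    and "spiral (run_start (4 * q + 3) + 1) = (- int q - 1, int q + 1)"
proof -
  have step: "spiral (run_start (4 * q + 1) + 1) = (int q + 1, - int q) \<and>
    spiral (run_start (4 * q + 2) + 1) = (int q + 1, int q + 1) \<and>
    spiral (run_start (4 * q + 3) + 1) = (- int q - 1, int q + 1) \<and>
    spiral (run_start (4 * q + 4) + 1) = (- int q - 1, - int q - 1)"
    if "spiral (run_start (4 * q) + 1) = (- int q, - int q)" for q
    using that spiral_next_corner[of "4 * q"] spiral_next_corner[of "4 * q + 1"] 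
      spiral_next_corner[of "4 * q + 2"] spiral_next_corner[of "4 * q + 3"]
    unfolding div2_4 run_direction_4 Suc_4 by simp
  have base: "spiral (run_start (4 * q) + 1) = (- int q, - int q)" for q
  proof (induction q)
    case 0
    then show ?case by (simp add: run_start_def spiral_def zero_prod_def)
  next
    case (Suc q)
    from step[OF this] show ?case by (simp add: algebra_simps)
  qed
  show "spiral (run_start (4 * q) + 1) = (- int q, - int q)"
    "spiral (run_start (4 * q + 1) + 1) = (int q + 1, - int q)"
    "spiral (run_start (4 * q + 2) + 1) = (int q + 1, int q + 1)"
    "spiral (run_start (4 * q + 3) + 1) = (- int q - 1, int q + 1)"
    using base step[OF base] by auto
qed

lemma run_start_4:
  "int (run_start (4 * q)) = 4 * (int q)\<^sup>2 + 2 * int q"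
  "int (run_start (4 * q + 1)) = 4 * (int q)\<^sup>2 + 4 * int q + 1"
  "int (run_start (4 * q + 2)) = 4 * (int q)\<^sup>2 + 6 * int q + 2"
  "int (run_start (4 * q + 3)) = 4 * (int q)\<^sup>2 + 8 * int q + 4"
proof -
  have "run_start (4 * q) = 2 * q * (2 * q + 1)" using run_start_even[of "2 * q"] by simp
  moreover have "run_start (4 * q + 1) = run_start (4 * q) + (2 * q + 1)" 
    using run_start_Suc[of "4 * q"] by (simp add: div2_4)
  moreover have "run_start (4 * q + 2) = run_start (4 * q + 1) + (2 * q + 1)" 
    using run_start_Suc[of "4 * q + 1"] unfolding div2_4 Suc_4 by simp
  moreover have "run_start (4 * q + 3) = run_start (4 * q + 2) + (2 * q + 2)" 
    using run_start_Suc[of "4 * q + 2"] unfolding div2_4 Suc_4 by simp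
  ultimately show "int (run_start (4 * q)) = 4 * (int q)\<^sup>2 + 2 * int q"
  "int (run_start (4 * q + 1)) = 4 * (int q)\<^sup>2 + 4 * int q + 1"
  "int (run_start (4 * q + 2)) = 4 * (int q)\<^sup>2 + 6 * int q + 2"
  "int (run_start (4 * q + 3)) = 4 * (int q)\<^sup>2 + 8 * int q + 4"
    by (simp_all add: power2_eq_square algebra_simps)
qed

lemma spiral_label_formulas:
  "- n \<le> x \<Longrightarrow> x \<le> n \<Longrightarrow> spiral_label (x, - n) = 4 * n\<^sup>2 + 3 * n + 1 + x"
  "- n < y \<Longrightarrow> y \<le> n \<Longrightarrow> spiral_label (n, y) = 4 * n\<^sup>2 - 3 * n + 1 + y"
  "- n \<le> x \<Longrightarrow> x \<le> n \<Longrightarrow> spiral_label (x, n) = 4 * n\<^sup>2 - n + 1 - x"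
  "- n \<le> y \<Longrightarrow> y \<le> n \<Longrightarrow> spiral_label (- n, y) = 4 * n\<^sup>2 + n + 1 - y"
proof -
  have r: "maxnorm (x, - n) = n" "maxnorm (x, n) = n" if "- n \<le> x" "x \<le> n"
    using that by (auto simp: maxnorm_def)
  have r': "maxnorm (n, y) = n" "maxnorm (- n, y) = n" if "- n \<le> y" "y \<le> n"
    using that by (auto simp: maxnorm_def)
  show "- n \<le> x \<Longrightarrow> x \<le> n \<Longrightarrow> spiral_label (x, - n) = 4 * n\<^sup>2 + 3 * n + 1 + x"
    "- n < y \<Longrightarrow> y \<le> n \<Longrightarrow> spiral_label (n, y) = 4 * n\<^sup>2 - 3 * n + 1 + y"
    "- n \<le> x \<Longrightarrow> x \<le> n \<Longrightarrow> spiral_label (x, n) = 4 * n\<^sup>2 - n + 1 - x"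
    "- n \<le> y \<Longrightarrow> y \<le> n \<Longrightarrow> spiral_label (- n, y) = 4 * n\<^sup>2 + n + 1 - y"
    unfolding spiral_label_def Let_def
    using r r' by (simp_all, auto simp: maxnorm_def)
qed

text \<open>The run containing \<open>k\<close> lies on one side of a square, where both the position of label \<open>k\<close> and the
  label formula are explicit.\<close>

lemma spiral_label_spiral:
  assumes "1 \<le> k"
  shows "spiral_label (spiral k) = int k"
proof -
  obtain j where j: "run_start j \<le> k - 1" "k - 1 < run_start (Suc j)" using run_exists by blast
  define s where "s = k - 1 - run_start j"
  have s: "s \<le> j div 2" "k = run_start j + s + 1" using j assms by (auto simp: s_def run_start_Suc)
  define q where "q = j div 4"
  have k: "spiral k = (fst (spiral (run_start j + 1)) + int s * fst (run_direction j), 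
      snd (spiral (run_start j + 1)) + int s * snd (run_direction j))"
    unfolding s(2) using s(1) by (intro spiral_along_run) simp
  consider "j = 4 * q" | "j = 4 * q + 1" | "j = 4 * q + 2" | "j = 4 * q + 3" unfolding q_def by linarith
  then show ?thesis
  proof cases
    case 1
    have pos: "spiral k = (- int q + int s, - int q)" unfolding k unfolding 1 spiral_corners run_direction_4 by simp
    have len: "s \<le> (4 * q) div 2" using s(1) 1 by simp
    have "int k = int (run_start (4 * q)) + int s + 1" using s(2) 1 by simp
    then show ?thesis
      using len unfolding pos run_start_4 div2_4 
      by (subst spiral_label_formulas(1)) (auto simp: power2_eq_square algebra_simps)
  next
    case 2
    have pos: "spiral k = (int q + 1, - int q + int s)" unfolding k unfolding 2 spiral_corners run_direction_4 by simp
    have len: "s \<le> (4 * q + 1) div 2" using s(1) 2 by simp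
    have "int k = int (run_start (4 * q + 1)) + int s + 1" using s(2) 2 by simp
    then show ?thesis
      using len unfolding pos run_start_4 div2_4 
      by (subst spiral_label_formulas(2)) (auto simp: power2_eq_square algebra_simps)
  next
    case 3
    have pos: "spiral k = (int q + 1 - int s, int q + 1)" unfolding k unfolding 3 spiral_corners run_direction_4 by simp
    have len: "s \<le> (4 * q + 2) div 2" using s(1) 3 by simp
    have "int k = int (run_start (4 * q + 2)) + int s + 1" using s(2) 3 by simp
    then show ?thesis
      using len unfolding pos run_start_4 div2_4 
      by (subst spiral_label_formulas(3)) (auto simp: power2_eq_square algebra_simps)
  next
    case 4
    have pos: "spiral k = (- (int q + 1), int q + 1 - int s)" unfolding k unfolding 4 spiral_corners run_direction_4 by simp
    have len: "s \<le> (4 * q + 3) div 2" using s(1) 4 by simp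
    have "int k = int (run_start (4 * q + 3)) + int s + 1" using s(2) 4 by simp
    then show ?thesis
      using len unfolding pos run_start_4 div2_4 
      by (subst spiral_label_formulas(4)) (auto simp: power2_eq_square algebra_simps)
  qed
qed

text \<open>An injective function that inverts the spiral from one side also inverts it from the other; this is
  the surjectivity of the spiral.\<close>

lemma spiral_spiral_label: "spiral (nat (spiral_label z)) = z"
proof -
  have "spiral_label (spiral (nat (spiral_label z))) = spiral_label z"
    using spiral_label_ge_1[of z] by (subst spiral_label_spiral) auto
  then show ?thesis using inj_spiral_label by (simp add: inj_eq)
qed

lemma inv_spiral: "inv_into {1..} spiral z = nat (spiral_label z)"
proof (rule inv_into_f_eq)
  show "inj_on spiral {1..}"
    by (rule inj_onI) (metis atLeast_iff spiral_label_spiral of_nat_eq_iff)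
qed (use spiral_label_ge_1[of z] spiral_spiral_label in auto)

section \<open>Sums of powers\<close>

text \<open>With \<open>s\<close> the sum of the \<open>a i\<close>, each term satisfies \<open>a i ^ q \<le> a i * s ^ (q - 1)\<close>.\<close>

lemma powr_superadditive_sum:
  fixes a :: "'a \<Rightarrow> real"
  assumes "1 \<le> q" and "finite I" and nn: "\<And>i. i \<in> I \<Longrightarrow> 0 \<le> a i"
  shows "(\<Sum>i\<in>I. a i powr q) \<le> (\<Sum>i\<in>I. a i) powr q"
proof -
  define s where "s = (\<Sum>i\<in>I. a i)"
  have s: "0 \<le> s" using nn by (auto simp: s_def intro: sum_nonneg)
  have split: "t powr q = t * t powr (q - 1)" if "0 \<le> t" for t :: real
    using that by (cases "t = 0") (auto simp: powr_mult_base)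
  have "a i powr q \<le> a i * s powr (q - 1)" if "i \<in> I" for i
  proof -
    have "a i \<le> s" unfolding s_def using that assms by (intro member_le_sum) auto
    then show ?thesis using that assms by (subst split) (auto intro!: mult_left_mono powr_mono2)
  qed
  then have "(\<Sum>i\<in>I. a i powr q) \<le> (\<Sum>i\<in>I. a i * s powr (q - 1))" by (rule sum_mono)
  also have "\<dots> = s * s powr (q - 1)" by (simp add: s_def sum_distrib_right)
  also have "\<dots> = s powr q" using split[OF s] by simp
  finally show ?thesis by (simp add: s_def)
qed

text \<open>Jensen's inequality for \<open>t \<mapsto> t ^ q\<close>. The zero terms drop out of both sums, which leaves the open
  half-line as the domain of convexity.\<close>

lemma powr_power_mean:
  fixes a :: "'a \<Rightarrow> real"
  assumes q: "1 \<le> q" and I: "finite I" "card I \<le> n" and nn: "\<And>i. i \<in> I \<Longrightarrow> 0 \<le> a i"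
  shows "(\<Sum>i\<in>I. a i) powr q \<le> real n powr (q - 1) * (\<Sum>i\<in>I. a i powr q)"
proof -
  define P where "P = {i \<in> I. 0 < a i}"
  have P: "finite P" "P \<subseteq> I" using I by (auto simp: P_def)
  have z: "a i = 0" if "i \<in> I - P" for i using that nn[of i] by (force simp: P_def)
  have sums: "(\<Sum>i\<in>I. a i) = (\<Sum>i\<in>P. a i)" "(\<Sum>i\<in>I. a i powr q) = (\<Sum>i\<in>P. a i powr q)"
    by (rule sum.mono_neutral_right; use I P z in force)+
  show ?thesis
  proof (cases "P = {}")
    case True
    then show ?thesis unfolding sums by simp
  next
    case False
    define c where "c = real (card P)"
    have c: "0 < c" "c \<le> real n"
      using False P card_mono[OF I(1) P(2)] I(2) by (auto simp: c_def card_gt_0_iff)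
    define t where "t = (\<Sum>i\<in>P. a i)"
    have t: "0 \<le> t" by (auto simp: t_def P_def intro: sum_nonneg)
    have "(\<Sum>i\<in>P. (1/c) *\<^sub>R a i) powr q \<le> (\<Sum>i\<in>P. (1/c) * a i powr q)"
      using convex_on_sum[OF P(1) False powr_convex[OF q], of "\<lambda>_. 1/c" a] c by (auto simp: P_def c_def)
    then have "(t / c) powr q \<le> (\<Sum>i\<in>P. a i powr q) / c"
      by (simp add: t_def sum_divide_distrib[symmetric])
    then have "c powr q * (t / c) powr q \<le> c powr q * ((\<Sum>i\<in>P. a i powr q) / c)"
      by (intro mult_left_mono) auto
    also have "c powr q * (t / c) powr q = t powr q"
      using c t by (simp add: powr_mult[symmetric])
    also have "c powr q * ((\<Sum>i\<in>P. a i powr q) / c) = c powr (q - 1) * (\<Sum>i\<in>P. a i powr q)"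
      using c by (simp add: powr_diff)
    also have "\<dots> \<le> real n powr (q - 1) * (\<Sum>i\<in>P. a i powr q)"
      using c q by (intro mult_right_mono powr_mono2 sum_nonneg) auto
    finally show ?thesis unfolding sums t_def .
  qed
qed

section \<open>Outer boundary of finite sets in the lattice\<close>

text \<open>Each occupied column contributes the point above its top and the point below its bottom.\<close>

lemma vertical_boundary:
  fixes A :: "lattice set"
  assumes A: "finite A"
  obtains Y where "finite Y" "Y \<inter> A = {}" "card Y = 2 * card (fst ` A)" "\<And>y. y \<in> Y \<Longrightarrow> \<exists>x\<in>A. adjacent x y"
proof -
  define C where "C x = {y. (x, y) \<in> A}" for x
  have fC: "finite (C x)" for x
    using finite_vimageI[OF A, of "Pair x"] by (simp add: C_def vimage_def inj_on_def)
  define up where "up x = (x, Max (C x) + 1)" for x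
  define dn where "dn x = (x, Min (C x) - 1)" for x
  have ne: "C x \<noteq> {}" if "x \<in> fst ` A" for x using that by (force simp: C_def)
  define Y where "Y = up ` (fst ` A) \<union> dn ` (fst ` A)"
  have mm: "Min (C x) \<le> Max (C x)" if "x \<in> fst ` A" for x
    using Min_in[OF fC ne[OF that]] Max_ge[OF fC] by blast
  have "up ` (fst ` A) \<inter> dn ` (fst ` A) = {}"
    using mm by (force simp: up_def dn_def)
  moreover have "card (up ` (fst ` A)) = card (fst ` A)" "card (dn ` (fst ` A)) = card (fst ` A)"
    by (auto intro!: card_image simp: inj_on_def up_def dn_def)
  ultimately have "card Y = 2 * card (fst ` A)"
    unfolding Y_def using A by (subst card_Un_disjoint) auto
  moreover have "finite Y" using A by (auto simp: Y_def)
  moreover have "Y \<inter> A = {}"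
  proof -
    have "up x \<notin> A" if "x \<in> fst ` A" for x
      using Max_ge[OF fC, of "Max (C x) + 1" x] by (auto simp: up_def C_def)
    moreover have "dn x \<notin> A" if "x \<in> fst ` A" for x
      using Min_le[OF fC, of "Min (C x) - 1" x] by (auto simp: dn_def C_def)
    ultimately show ?thesis unfolding Y_def by blast
  qed
  moreover have "\<exists>x\<in>A. adjacent x y" if "y \<in> Y" for y
  proof -
    from that obtain x where x: "x \<in> fst ` A" "y = up x \<or> y = dn x" by (auto simp: Y_def)
    have "(x, Max (C x)) \<in> A" "(x, Min (C x)) \<in> A"
      using Max_in[OF fC ne[OF x(1)]] Min_in[OF fC ne[OF x(1)]] by (auto simp: C_def)
    moreover have "adjacent (x, Max (C x)) (up x)" "adjacent (x, Min (C x)) (dn x)"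
      by (auto simp: adjacent_def up_def dn_def)
    ultimately show ?thesis using x(2) by blast
  qed
  ultimately show thesis using that by blast
qed

text \<open>A set with \<open>a\<close> occupied columns and \<open>b\<close> occupied rows has at most \<open>a b \<le> (max a b)\<^sup>2\<close> points, so the
  larger of the two directions gives the claim with \<open>s = max a b\<close>.\<close>

lemma vertex_boundary:
  fixes A :: "lattice set"
  assumes A: "finite A"
  obtains Y s where "finite Y" "Y \<inter> A = {}" "card Y = 2 * s" "card A \<le> s\<^sup>2" "\<And>y. y \<in> Y \<Longrightarrow> \<exists>x\<in>A. adjacent x y"
proof -
  define a b where "a = card (fst ` A)" and "b = card (snd ` A)"
  have "card A \<le> card (fst ` A \<times> snd ` A)"
    using A by (intro card_mono subset_fst_snd) auto
  then have ab: "card A \<le> a * b" by (simp add: card_cartesian_product a_def b_def)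
  show thesis
  proof (cases "b \<le> a")
    case True
    then have "card A \<le> a\<^sup>2" using mult_le_mono2[OF True, of a] by (intro order_trans[OF ab]) (simp add: power2_eq_square)
    then show thesis using vertical_boundary[OF A] that unfolding a_def by metis
  next
    case False
    then have "card A \<le> b\<^sup>2" using mult_le_mono1[of a b b] by (intro order_trans[OF ab]) (simp add: power2_eq_square)
    obtain Y where Y: "finite Y" "Y \<inter> prod.swap ` A = {}" "card Y = 2 * card (fst ` prod.swap ` A)" 
      "\<And>y. y \<in> Y \<Longrightarrow> \<exists>x\<in>prod.swap ` A. adjacent x y"
      using vertical_boundary[of "prod.swap ` A"] A by blast
    have "card (prod.swap ` Y) = 2 * b"
      using Y(3) by (simp add: card_image b_def image_image)
    moreover have "prod.swap ` Y \<inter> A = {}" using Y(2) by force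
    moreover have "\<exists>x\<in>A. adjacent x y" if "y \<in> prod.swap ` Y" for y
    proof -
      from that obtain u where u: "u \<in> Y" "y = prod.swap u" by blast
      obtain x where "x \<in> A" "adjacent (prod.swap x) u" using Y(4)[OF u(1)] by blast
      then show ?thesis using u(2) by (auto simp: adjacent_def add.commute intro!: bexI[of _ x])
    qed
    ultimately show thesis using that[of "prod.swap ` Y" b] Y(1) \<open>card A \<le> b\<^sup>2\<close> by blast
  qed
qed

section \<open>The decreasing sequence of values\<close>

text \<open>The supremum is attained: above any positive admissible level \<open>t0\<close>, the admissible sets lie in the
  finite set where \<open>\<bar>f\<bar> > t0 / 2\<close>, so only finitely many minima compete.\<close>

lemma kth_largest_greatest:
  assumes van: "vanishes_at_infinity f" and k: "1 \<le> k"
  shows "\<exists>m. (0 \<le> m \<and> (\<exists>A. finite A \<and> card A = k \<and> (\<forall>x\<in>A. m \<le> \<bar>f x\<bar>))) \<and>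
     (\<forall>t. 0 \<le> t \<and> (\<exists>A. finite A \<and> card A = k \<and> (\<forall>x\<in>A. t \<le> \<bar>f x\<bar>)) \<longrightarrow> t \<le> m)"
   (is "\<exists>m. ?P m \<and> (\<forall>t. ?P t \<longrightarrow> t \<le> m)")
proof (cases "\<exists>t0>0. ?P t0")
  case False
  have "infinite (UNIV :: lattice set)" by (simp add: finite_prod)
  then obtain A :: "lattice set" where "finite A" "card A = k" 
    by (meson infinite_arbitrarily_large)
  then have "?P 0" by auto
  then show ?thesis using False by (metis less_eq_real_def)
next
  case True
  then obtain t0 where t0: "t0 > 0" "?P t0" by blast
  define W where "W = {x. t0 / 2 < \<bar>f x\<bar>}"
  have W: "finite W" using van[unfolded vanishes_at_infinity_def, rule_format, of "t0 / 2"] t0(1) by (simp add: W_def)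
  define low where "low A = Min ((\<lambda>x. \<bar>f x\<bar>) ` A)" for A
  define V where "V = low ` {A. A \<subseteq> W \<and> card A = k}"
  have V: "finite V" unfolding V_def using W by auto
  have ex: "\<exists>v\<in>V. t \<le> v" if "?P t" "t0 \<le> t" for t
  proof -
    from that(1) obtain A where A: "finite A" "card A = k" "\<forall>x\<in>A. t \<le> \<bar>f x\<bar>" by blast
    have "A \<subseteq> W" using A(3) that(2) t0 by (force simp: W_def)
    moreover have "A \<noteq> {}" using A k by auto
    then have "t \<le> low A" unfolding low_def using A by auto
    ultimately show ?thesis using A unfolding V_def by blast
  qed
  have "V \<noteq> {}" using ex t0 by blast
  define m where "m = Max V"
  have up: "t \<le> m" if "?P t" "t0 \<le> t" for t 
    using ex[OF that] V by (auto simp: m_def intro: order_trans[OF _ Max_ge])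
  have "t0 \<le> m" using up t0 by blast
  obtain A where A: "A \<subseteq> W" "card A = k" "m = low A"
    using Max_in[OF V \<open>V \<noteq> {}\<close>] unfolding m_def V_def by auto
  have "finite A" using A W finite_subset by blast
  then have "\<forall>x\<in>A. m \<le> \<bar>f x\<bar>" unfolding A(3) low_def by auto
  then have "?P m" using A \<open>finite A\<close> \<open>t0 \<le> m\<close> t0 by auto
  moreover have "t \<le> m" if "?P t" for t
    using up[OF that] \<open>t0 \<le> m\<close> by (cases "t0 \<le> t") auto
  ultimately show ?thesis by blast
qed

lemma
  assumes "vanishes_at_infinity f" and "1 \<le> k"
  shows kth_largest_nonneg: "0 \<le> kth_largest f k"
    and kth_largest_attained: "\<exists>A. finite A \<and> card A = k \<and> (\<forall>x\<in>A. kth_largest f k \<le> \<bar>f x\<bar>)"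
    and kth_largest_upper: "\<lbrakk>0 \<le> t; finite B; k \<le> card B; \<And>x. x \<in> B \<Longrightarrow> t \<le> \<bar>f x\<bar>\<rbrakk> \<Longrightarrow> t \<le> kth_largest f k"
proof -
  let ?P = "\<lambda>t. 0 \<le> t \<and> (\<exists>A. finite A \<and> card A = k \<and> (\<forall>x\<in>A. t \<le> \<bar>f x\<bar>))"
  from kth_largest_greatest[OF assms] obtain m where m: "?P m" "\<And>t. ?P t \<Longrightarrow> t \<le> m" by auto
  have eq: "kth_largest f k = m"
    unfolding kth_largest_def by (rule Greatest_equality) (use m in blast)+
  show "0 \<le> kth_largest f k" "\<exists>A. finite A \<and> card A = k \<and> (\<forall>x\<in>A. kth_largest f k \<le> \<bar>f x\<bar>)"
    using m(1) unfolding eq by auto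
  show "t \<le> kth_largest f k" if "0 \<le> t" "finite B" "k \<le> card B" "\<And>x. x \<in> B \<Longrightarrow> t \<le> \<bar>f x\<bar>"
  proof -
    obtain A where "A \<subseteq> B" "card A = k" "finite A" using obtain_subset_with_card_n[OF \<open>k \<le> card B\<close>] by metis
    then have "?P t" using that by blast
    then show ?thesis using m(2) unfolding eq by blast
  qed
qed

lemma kth_largest_antimono:
  assumes "vanishes_at_infinity f" and "1 \<le> j" and "j \<le> k"
  shows "kth_largest f k \<le> kth_largest f j"
  using kth_largest_attained[of f k] kth_largest_nonneg[of f k] kth_largest_upper[of f j "kth_largest f k"] assms
  by (metis order_trans)

section \<open>Blocks of values and the edges of the function\<close>

text \<open>The growth of the blocks is a compromise. Three consecutive blocks must be longer than a gap between
  neighbours on the spiral, about \<open>4 sqrt k\<close>, while one block must stay well below the number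
  \<open>2 sqrt k\<close> of guaranteed boundary points. Block lengths \<open>i + 1 \<approx> sqrt (2 k)\<close> satisfy both.\<close>

definition breakpoint :: "nat \<Rightarrow> nat" where
  "breakpoint i = 1 + i * (i + 1) div 2"

lemma breakpoint_0 [simp]: "breakpoint 0 = 1"
  by (simp add: breakpoint_def)

lemma breakpoint_Suc: "breakpoint (Suc i) = breakpoint i + i + 1"
  by (simp add: breakpoint_def)

lemma breakpoint_ge_1: "1 \<le> breakpoint i"
  by (simp add: breakpoint_def)

lemma double_breakpoint: "2 * breakpoint i = i * (i + 1) + 2"
  by (induction i) (auto simp: breakpoint_Suc)

lemma breakpoint_ge: "i < breakpoint i"
  by (induction i) (auto simp: breakpoint_Suc)

definition block_drop :: "(lattice \<Rightarrow> real) \<Rightarrow> nat \<Rightarrow> real" where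
  "block_drop f i = kth_largest f (breakpoint i) - kth_largest f (breakpoint (Suc i))"

lemma block_drop_nonneg: "vanishes_at_infinity f \<Longrightarrow> 0 \<le> block_drop f i"
  using kth_largest_antimono[of f "breakpoint i" "breakpoint (Suc i)"] breakpoint_ge_1
  by (simp add: block_drop_def breakpoint_Suc)

text \<open>The endpoints of the edge lie on different sides of the whole block: the edge sees the full drop.\<close>

definition spans_block :: "(lattice \<Rightarrow> real) \<Rightarrow> nat \<Rightarrow> lattice set \<Rightarrow> bool" where
  "spans_block f i e \<longleftrightarrow> (\<exists>x y. e = {x, y} \<and> 
     kth_largest f (breakpoint i) \<le> \<bar>f x\<bar> \<and> \<bar>f y\<bar> \<le> kth_largest f (breakpoint (Suc i)))"

lemma block_drop_le_edge_diff:
  assumes "vanishes_at_infinity f" "spans_block f i e"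
  shows "block_drop f i \<le> edge_diff f e"
  using assms(2) block_drop_nonneg[OF assms(1), of i] by (auto simp: spans_block_def block_drop_def)

text \<open>Start from \<open>K i\<close> points with values at least \<open>u = v (K i)\<close>. If more than \<open>i\<close> of their outer boundary points
  had values above \<open>v (K (i + 1))\<close>, there would be \<open>K (i + 1)\<close> points above that level, which is
  absurd. Every other boundary point yields an edge, and distinct boundary points yield distinct edges.\<close>

lemma many_spanning_edges:
  assumes van: "vanishes_at_infinity f" and pos: "0 < block_drop f i"
  obtains E where "finite E" "E \<subseteq> edges" "5 * i + 11 \<le> 16 * card E" "\<And>e. e \<in> E \<Longrightarrow> spans_block f i e"
proof -
  define u v where "u = kth_largest f (breakpoint i)" and "v = kth_largest f (breakpoint (Suc i))"
  have uv: "v < u" using pos by (simp add: u_def v_def block_drop_def)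
  have v0: "0 \<le> v" unfolding v_def using van breakpoint_ge_1 by (rule kth_largest_nonneg)
  obtain A where A: "finite A" "card A = breakpoint i" "\<forall>x\<in>A. u \<le> \<bar>f x\<bar>"
    unfolding u_def using kth_largest_attained[OF van breakpoint_ge_1] by blast
  obtain Y s where Y: "finite Y" "Y \<inter> A = {}" "card Y = 2 * s" "card A \<le> s\<^sup>2"
      "\<And>y. y \<in> Y \<Longrightarrow> \<exists>x\<in>A. adjacent x y"
    using vertex_boundary[OF A(1)] by blast
  define H where "H = {y \<in> Y. v < \<bar>f y\<bar>}"
  have H: "finite H" "H \<inter> A = {}" using Y by (auto simp: H_def)
  have "card H \<le> i"
  proof (rule ccontr)
    assume "\<not> card H \<le> i"
    then have c: "breakpoint (Suc i) \<le> card (A \<union> H)"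
      using A H by (subst card_Un_disjoint) (auto simp: breakpoint_Suc)
    define t where "t = Min ((\<lambda>x. \<bar>f x\<bar>) ` (A \<union> H))"
    have ne: "A \<union> H \<noteq> {}" using c breakpoint_ge_1[of "Suc i"] by auto
    \<comment> \<open>The least value \<open>t\<close> on the enlarged set would exceed \<open>v\<close>.\<close>
    have vt: "v < t" unfolding t_def
      using A H ne uv by (subst Min_gr_iff) (auto simp: H_def)
    have "t \<le> v" unfolding v_def
      by (rule kth_largest_upper[OF van breakpoint_ge_1 _ _ c])
        (use A H vt v0 in \<open>auto simp: t_def\<close>)
    then show False using vt by simp
  qed
  define far where "far = Y - H"
  have "card far = 2 * s - card H" unfolding far_def H_def using Y
    by (subst card_Diff_subset) auto
  then have far: "2 * s \<le> card far + i" using \<open>card H \<le> i\<close> by simp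
  obtain x where x: "\<And>y. y \<in> Y \<Longrightarrow> x y \<in> A \<and> adjacent (x y) y" using Y(5) by metis
  define E where "E = (\<lambda>y. {x y, y}) ` far"
  have "inj_on (\<lambda>y. {x y, y}) far"
    using x Y(2) by (auto simp: inj_on_def far_def doubleton_eq_iff)
  then have card: "card E = card far" unfolding E_def by (rule card_image)
  have "5 * i + 11 \<le> 16 * card E"
  proof -
    \<comment> \<open>Since \<open>16 (2 s - i) \<ge> 5 i + 11\<close> amounts to \<open>32 s \<ge> 21 i + 11\<close>, compare squares.\<close>
    have "2 * s\<^sup>2 \<ge> i * (i + 1) + 2" using Y(4) A(2) double_breakpoint[of i] by simp
    then have "(21 * i + 11)\<^sup>2 \<le> (32 * s)\<^sup>2" by (simp add: power2_eq_square algebra_simps)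
    then have "21 * i + 11 \<le> 32 * s" by (rule power2_le_imp_le) simp
    then show ?thesis using far card by simp
  qed
  moreover have "finite E" using Y by (simp add: E_def far_def)
  moreover have "E \<subseteq> edges" using x unfolding E_def far_def edges_def by blast
  moreover have "spans_block f i e" if "e \<in> E" for e
  proof -
    from that obtain y where "y \<in> far" and e: "e = {x y, y}" unfolding E_def by blast
    then have y: "y \<in> Y" "\<bar>f y\<bar> \<le> v" by (auto simp: far_def H_def)
    show ?thesis using e y x[OF y(1)] A(3) unfolding spans_block_def u_def v_def by blast
  qed
  ultimately show thesis using that by blast
qed

text \<open>Clamping the values at the breakpoints to the interval between the two values of \<open>\<bar>f\<bar>\<close> on the edge
  does not change the drops of spanned blocks, and the clamped drops telescope to at most the length of
  that interval.\<close>

lemma sum_spanned_drops_le: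
  assumes van: "vanishes_at_infinity f" and e: "e \<in> edges" and fin: "finite I"
    and sp: "\<And>i. i \<in> I \<Longrightarrow> spans_block f i e"
  shows "(\<Sum>i\<in>I. block_drop f i) \<le> edge_diff f e"
proof -
  obtain x y where xy: "e = {x, y}" using e by (auto simp: edges_def)
  define lo hi where "lo = min \<bar>f x\<bar> \<bar>f y\<bar>" and "hi = max \<bar>f x\<bar> \<bar>f y\<bar>"
  define c where "c i = max lo (min hi (kth_largest f (breakpoint i)))" for i
  obtain n where n: "I \<subseteq> {..<n}" using fin finite_nat_iff_bounded by blast
  have dec: "kth_largest f (breakpoint (Suc i)) \<le> kth_largest f (breakpoint i)" for i
    using block_drop_nonneg[OF van, of i] by (simp add: block_drop_def)
  have "block_drop f i = c i - c (Suc i)" if "i \<in> I" for i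
    using sp[OF that] dec[of i] unfolding spans_block_def xy
    by (auto simp: doubleton_eq_iff block_drop_def c_def lo_def hi_def)
  then have "(\<Sum>i\<in>I. block_drop f i) = (\<Sum>i\<in>I. c i - c (Suc i))" by simp
  also have "\<dots> \<le> (\<Sum>i<n. c i - c (Suc i))"
  proof (rule sum_mono2)
    show "0 \<le> c i - c (Suc i)" for i
      using max.mono[OF order_refl[of lo] min.mono[OF order_refl[of hi] dec[of i]]] by (simp add: c_def)
  qed (use n in auto)
  also have "\<dots> = c 0 - c n" by (rule sum_lessThan_telescope')
  also have "\<dots> \<le> hi - lo"
  proof -
    have "lo \<le> hi" by (simp add: lo_def hi_def)
    then have "c 0 \<le> hi" "lo \<le> c n" by (simp_all add: c_def)
    then show ?thesis by simp
  qed
  also have "\<dots> \<le> edge_diff f e"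
    by (cases "\<bar>f x\<bar> \<le> \<bar>f y\<bar>") (simp_all add: xy lo_def hi_def)
  finally show ?thesis .
qed

text \<open>Double counting of pairs of a block and an edge spanning it.\<close>

lemma weighted_drops_le:
  assumes van: "vanishes_at_infinity f" and q: "1 \<le> q"
  obtains G where "finite G" "G \<subseteq> edges"
    "(\<Sum>i<n. real (5 * i + 11) * block_drop f i powr q) \<le> 16 * (\<Sum>e\<in>G. edge_diff f e powr q)"
proof -
  have "\<exists>E. finite E \<and> E \<subseteq> edges \<and> (0 < block_drop f i \<longrightarrow> 5 * i + 11 \<le> 16 * card E) \<and> (\<forall>e\<in>E. spans_block f i e)" for i
  proof (cases "0 < block_drop f i")
    case True
    then show ?thesis using many_spanning_edges[OF van] by metis
  next
    case False
    then show ?thesis by (intro exI[of _ "{}"]) auto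
  qed
  then obtain E where E: "\<And>i. finite (E i)" "\<And>i. E i \<subseteq> edges" 
      "\<And>i. 0 < block_drop f i \<Longrightarrow> 5 * i + 11 \<le> 16 * card (E i)" "\<And>i e. e \<in> E i \<Longrightarrow> spans_block f i e"
    by metis
  define G where "G = (\<Union>i<n. E i)"
  have G: "finite G" "G \<subseteq> edges" using E by (auto simp: G_def)
  have "(\<Sum>i<n. real (5 * i + 11) * block_drop f i powr q) \<le> (\<Sum>i<n. 16 * real (card (E i)) * block_drop f i powr q)"
  proof (rule sum_mono)
    fix i
    show "real (5 * i + 11) * block_drop f i powr q \<le> 16 * real (card (E i)) * block_drop f i powr q"
    proof (cases "block_drop f i = 0")
      case False
      then have "5 * i + 11 \<le> 16 * card (E i)" using block_drop_nonneg[OF van, of i] E(3) by simp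
      then have "real (5 * i + 11) \<le> 16 * real (card (E i))" by linarith
      then show ?thesis by (rule mult_right_mono) simp
    qed simp
  qed
  also have "\<dots> = 16 * (\<Sum>i<n. \<Sum>e\<in>G. if e \<in> E i then block_drop f i powr q else 0)"
  proof -
    have "(\<Sum>e\<in>G. if e \<in> E i then block_drop f i powr q else 0) = real (card (E i)) * block_drop f i powr q" if "i < n" for i
    proof -
      have "G \<inter> E i = E i" using that by (auto simp: G_def)
      then show ?thesis using G(1) by (simp add: sum.If_cases)
    qed
    then show ?thesis by (simp add: sum_distrib_left mult.assoc)
  qed
  also have "\<dots> = 16 * (\<Sum>e\<in>G. \<Sum>i<n. if e \<in> E i then block_drop f i powr q else 0)"
    by (subst sum.swap) simp
  also have "\<dots> \<le> 16 * (\<Sum>e\<in>G. edge_diff f e powr q)"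
  proof (intro mult_left_mono sum_mono)
    fix e assume e: "e \<in> G"
    define I where "I = {i. i < n \<and> e \<in> E i}"
    have "(\<Sum>i<n. if e \<in> E i then block_drop f i powr q else 0) = (\<Sum>i\<in>I. block_drop f i powr q)"
      by (simp add: sum.If_cases I_def lessThan_def Int_def)
    also have "\<dots> \<le> (\<Sum>i\<in>I. block_drop f i) powr q"
      using q block_drop_nonneg[OF van] by (intro powr_superadditive_sum) (auto simp: I_def)
    also have "\<dots> \<le> edge_diff f e powr q"
      using q e G E(4) block_drop_nonneg[OF van]
      by (intro powr_mono2 sum_spanned_drops_le[OF van] sum_nonneg) (auto simp: I_def)
    finally show "(\<Sum>i<n. if e \<in> E i then block_drop f i powr q else 0) \<le> edge_diff f e powr q" .
  qed simp
  finally show thesis using that G by blast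
qed

section \<open>Blocks of values and the edges of the rearrangement\<close>

lemma spiral_rearrangement_eq:
  "spiral_rearrangement f z = kth_largest f (nat (spiral_label z))"
  unfolding rearrangement_def inv_spiral ..

text \<open>The labels between \<open>z\<close> and \<open>w\<close> would otherwise contain the three blocks \<open>i - 3\<close>, \<open>i - 2\<close>, \<open>i - 1\<close>,
  more than the gap bound permits.\<close>

lemma lower_label_ge_breakpoint:
  assumes adj: "adjacent z w" and less: "spiral_label z < spiral_label w"
    and above: "int (breakpoint i) < spiral_label w"
  shows "int (breakpoint (i - 3)) \<le> spiral_label z"
proof (cases "i \<le> 3")
  case True
  then show ?thesis using spiral_label_ge_1[of z] by simp
next
  case False
  define a where "a = i - 4"
  have i: "i = a + 4" using False by (simp add: a_def)
  define k where "k = spiral_label z"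
  define d where "d = spiral_label w - k"
  show ?thesis
  proof (rule ccontr)
    assume "\<not> ?thesis"
    then have k: "k < int (breakpoint (Suc a))" by (simp add: k_def i)
    have K: "2 * int (breakpoint j) = int j * (int j + 1) + 2" for j
      using arg_cong[OF double_breakpoint[of j], of int] by (simp add: algebra_simps)
    \<comment> \<open>The label \<open>k\<close> lies below \<open>K (a + 1)\<close> and \<open>k + d\<close> above \<open>K (a + 4)\<close>, so \<open>d\<close> is at least \<open>3 a + 11\<close>.\<close>
    have k2: "2 * k \<le> (int a + 1) * (int a + 2)"
      using k K[of "Suc a"] by (simp add: algebra_simps)
    have "(int a + 4) * (int a + 5) + 2 < 2 * (k + d)"
      using above K[of i] by (simp add: i d_def algebra_simps)
    then have "3 * int a + 6 \<le> d - 5" using k2 by (simp add: algebra_simps)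
    then have "(3 * int a + 6)\<^sup>2 \<le> (d - 5)\<^sup>2" by (intro power_mono) auto
    also have "\<dots> \<le> 16 * k" using lower_neighbour_gap[OF adj less] by (simp add: d_def k_def)
    also have "\<dots> \<le> 8 * ((int a + 1) * (int a + 2))" using k2 by simp
    finally have "0 \<le> - (int a * int a) - 12 * int a - 20" by (simp add: power2_eq_square algebra_simps)
    moreover have "0 \<le> int a * int a" by simp
    ultimately show False by linarith
  qed
qed

lemma edge_orient:
  assumes "e \<in> edges"
  obtains z w where "e = {z, w}" "adjacent z w" "spiral_label z < spiral_label w"
proof -
  obtain x y where xy: "e = {x, y}" "adjacent x y" using assms by (auto simp: edges_def)
  have "x \<noteq> y" using xy(2) by (auto simp: adjacent_def)
  then have "spiral_label x \<noteq> spiral_label y" using inj_spiral_label by (auto dest: injD)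
  moreover have "adjacent y x" using xy(2) by (simp add: adjacent_def abs_minus_commute)
  moreover have "e = {y, x}" using xy(1) by blast
  ultimately show thesis
    using that[of x y] that[of y x] xy by (metis linorder_neq_iff)
qed

lemma rearranged_edge_diff:
  assumes van: "vanishes_at_infinity f" and "spiral_label z \<le> spiral_label w"
  shows "edge_diff (spiral_rearrangement f) {z, w} =
    kth_largest f (nat (spiral_label z)) - kth_largest f (nat (spiral_label w))"
  using kth_largest_antimono[OF van, of "nat (spiral_label z)" "nat (spiral_label w)"] assms(2) spiral_label_ge_1[of z]
  by (simp add: spiral_rearrangement_eq)

lemma sum_drops: "i \<le> j \<Longrightarrow> (\<Sum>m\<in>{i..j}. block_drop f m) = kth_largest f (breakpoint i) - kth_largest f (breakpoint (Suc j))"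
  unfolding block_drop_def by (induction j rule: dec_induct) auto

lemma rearranged_edge_diff_le_drops:
  assumes van: "vanishes_at_infinity f" and adj: "adjacent z w" and less: "spiral_label z < spiral_label w"
    and l: "int (breakpoint i) < spiral_label w" "spiral_label w \<le> int (breakpoint (Suc i))"
  shows "edge_diff (spiral_rearrangement f) {z, w} \<le> (\<Sum>m\<in>{i - 3..i}. block_drop f m)"
proof -
  have "int (breakpoint (i - 3)) \<le> spiral_label z"
    using lower_label_ge_breakpoint[OF adj less l(1)] .
  then have "kth_largest f (nat (spiral_label z)) \<le> kth_largest f (breakpoint (i - 3))"
    by (intro kth_largest_antimono[OF van breakpoint_ge_1]) simp
  moreover have "kth_largest f (breakpoint (Suc i)) \<le> kth_largest f (nat (spiral_label w))"
    using spiral_label_ge_1[of w] l(2) by (intro kth_largest_antimono[OF van]) auto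
  ultimately show ?thesis
    unfolding rearranged_edge_diff[OF van less_imp_le[OF less]] by (simp add: sum_drops)
qed

lemma consecutive_edge_diff_le_drop:
  assumes van: "vanishes_at_infinity f" and c: "spiral_label z = spiral_label w - 1"
    and l: "int (breakpoint i) < spiral_label w" "spiral_label w \<le> int (breakpoint (Suc i))"
  shows "edge_diff (spiral_rearrangement f) {z, w} \<le> block_drop f i"
proof -
  have "kth_largest f (nat (spiral_label z)) \<le> kth_largest f (breakpoint i)"
    using c l by (intro kth_largest_antimono[OF van breakpoint_ge_1]) simp
  moreover have "kth_largest f (breakpoint (Suc i)) \<le> kth_largest f (nat (spiral_label w))"
    using spiral_label_ge_1[of w] l(2) by (intro kth_largest_antimono[OF van]) auto
  moreover have "spiral_label z \<le> spiral_label w" using c by simp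
  ultimately show ?thesis
    unfolding rearranged_edge_diff[OF van \<open>spiral_label z \<le> spiral_label w\<close>] block_drop_def by simp
qed

text \<open>Edges of the rearrangement are counted by their larger label.\<close>

definition top_label :: "lattice set \<Rightarrow> nat" where
  "top_label e = nat (Max (spiral_label ` e))"

lemma top_label_eq: "spiral_label z < spiral_label w \<Longrightarrow> top_label {z, w} = nat (spiral_label w)"
  by (simp add: top_label_def)

lemma sum_subset_singleton_le:
  fixes g :: "'a \<Rightarrow> real"
  assumes "S \<subseteq> {x}" "0 \<le> a" "\<And>y. y \<in> S \<Longrightarrow> g y \<le> a"
  shows "sum g S \<le> a"
  using assms by (cases "S = {}") (auto dest: subset_singletonD)

text \<open>The at most two edges below label \<open>l\<close>: the one to the predecessor gives the first term, the one to the
  inward neighbour the second, through the power mean inequality for at most four drops.\<close>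

lemma sum_edges_with_top_label_le:
  assumes van: "vanishes_at_infinity f" and q: "1 \<le> q" and F: "F \<subseteq> edges" "finite F"
    and l: "breakpoint i < l" "l \<le> breakpoint (Suc i)"
  shows "(\<Sum>e\<in>{e \<in> F. top_label e = l}. edge_diff (spiral_rearrangement f) e powr q)
    \<le> block_drop f i powr q + 4 powr (q - 1) * (\<Sum>m\<in>{i - 3..i}. block_drop f m powr q)"
proof -
  define T where "T = {e \<in> F. top_label e = l}"
  define w where "w = spiral l"
  define e1 where "e1 = {spiral (l - 1), w}"
  let ?g = "\<lambda>e. edge_diff (spiral_rearrangement f) e powr q"
  have l1: "1 < l" using l(1) breakpoint_ge_1[of i] by linarith
  have lw: "spiral_label w = int l" using l1 by (simp add: w_def spiral_label_spiral)
  have prev: "spiral_label (spiral (l - 1)) = spiral_label w - 1"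
    using l1 by (simp add: spiral_label_spiral lw of_nat_diff)
  have T: "\<exists>z. e = {z, w} \<and> adjacent z w \<and> spiral_label z < spiral_label w" if "e \<in> T" for e
  proof -
    have "e \<in> edges" using that F by (auto simp: T_def)
    then obtain z w' where e: "e = {z, w'}" "adjacent z w'" "spiral_label z < spiral_label w'"
      using edge_orient by blast
    then have "spiral_label w' = int l" using that spiral_label_ge_1[of w'] by (auto simp: T_def top_label_eq)
    then have "w' = w" using lw inj_spiral_label by (metis injD)
    then show ?thesis using e by blast
  qed
  have fin: "finite T" using F by (simp add: T_def)
  have nonneg: "0 \<le> edge_diff (spiral_rearrangement f) e" if "e \<in> T" for e using T[OF that] by auto
  have "sum ?g (T \<inter> {e1}) \<le> block_drop f i powr q"
  proof (rule sum_subset_singleton_le)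
    fix e assume e: "e \<in> T \<inter> {e1}"
    have "edge_diff (spiral_rearrangement f) e1 \<le> block_drop f i"
      unfolding e1_def using l lw prev by (intro consecutive_edge_diff_le_drop[OF van]) auto
    then show "?g e \<le> block_drop f i powr q" using e nonneg q by (intro powr_mono2) auto
  qed auto
  moreover have "sum ?g (T - {e1}) \<le> 4 powr (q - 1) * (\<Sum>m\<in>{i - 3..i}. block_drop f m powr q)"
  proof (rule sum_subset_singleton_le)
    show "T - {e1} \<subseteq> {{inward w, w}}"
    proof
      fix e assume e: "e \<in> T - {e1}"
      then obtain z where z: "e = {z, w}" "adjacent z w" "spiral_label z < spiral_label w" using T by blast
      have "z \<noteq> spiral (l - 1)" using e z(1) by (auto simp: e1_def)
      then have "spiral_label z \<noteq> spiral_label w - 1"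
        using prev inj_spiral_label by (metis injD)
      then show "e \<in> {{inward w, w}}" using lower_neighbour[OF z(2,3)] z(1) by simp
    qed
    fix e assume "e \<in> T - {e1}"
    then obtain z where z: "e = {z, w}" "adjacent z w" "spiral_label z < spiral_label w" using T by blast
    have "edge_diff (spiral_rearrangement f) {z, w} \<le> (\<Sum>m\<in>{i - 3..i}. block_drop f m)"
      using z l lw by (intro rearranged_edge_diff_le_drops[OF van]) auto
    then have "?g e \<le> (\<Sum>m\<in>{i - 3..i}. block_drop f m) powr q"
      using q unfolding z(1) by (intro powr_mono2) auto
    also have "\<dots> \<le> real 4 powr (q - 1) * (\<Sum>m\<in>{i - 3..i}. block_drop f m powr q)"
      using q block_drop_nonneg[OF van] by (intro powr_power_mean) auto
    finally show "?g e \<le> 4 powr (q - 1) * (\<Sum>m\<in>{i - 3..i}. block_drop f m powr q)" by simp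
  qed (auto intro!: mult_nonneg_nonneg sum_nonneg)
  moreover have "sum ?g T = sum ?g (T \<inter> {e1}) + sum ?g (T - {e1})"
    using fin by (rule sum.Int_Diff)
  ultimately show ?thesis unfolding T_def by linarith
qed

lemma sum_by_blocks:
  "(\<Sum>l\<in>{1<..breakpoint n}. c l) = (\<Sum>i<n. \<Sum>l\<in>{breakpoint i<..breakpoint (Suc i)}. c l :: real)"
proof (induction n)
  case 0
  then show ?case by simp
next
  case (Suc n)
  have "{1<..breakpoint (Suc n)} = {1<..breakpoint n} \<union> {breakpoint n<..breakpoint (Suc n)}"
    using breakpoint_ge_1[of n] by (auto simp: breakpoint_Suc)
  then show ?case using Suc by (simp add: sum.union_disjoint ivl_disj_int)
qed

text \<open>Exchange of summation; \<open>d m\<close> occurs for \<open>i = m, \<dots>, m + 3\<close>, with total weight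
  \<open>(m + 1) + (m + 2) + (m + 3) + (m + 4) = 4 m + 10\<close>. For \<open>i < 3\<close> the truncated subtraction makes the
  window start at \<open>0\<close>.\<close>

lemma sum_of_windows:
  fixes d :: "nat \<Rightarrow> real"
  assumes d: "\<And>i. 0 \<le> d i"
  shows "(\<Sum>i<n. real (i + 1) * (\<Sum>m\<in>{i - 3..i}. d m)) \<le> (\<Sum>m<n. real (4 * m + 10) * d m)"
proof -
  have "(\<Sum>i<n. real (i + 1) * (\<Sum>m\<in>{i - 3..i}. d m)) = (\<Sum>i<n. \<Sum>m<n. if m \<le> i \<and> i \<le> m + 3 then real (i + 1) * d m else 0)"
  proof (rule sum.cong)
    fix i assume "i \<in> {..<n}"
    then have "{m. m < n \<and> m \<le> i \<and> i \<le> m + 3} = {i - 3..i}" by auto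
    then show "real (i + 1) * (\<Sum>m\<in>{i - 3..i}. d m) = (\<Sum>m<n. if m \<le> i \<and> i \<le> m + 3 then real (i + 1) * d m else 0)"
      by (simp add: sum.If_cases sum_distrib_left lessThan_def Int_def)
  qed simp
  also have "\<dots> = (\<Sum>m<n. \<Sum>i<n. if m \<le> i \<and> i \<le> m + 3 then real (i + 1) * d m else 0)"
    by (rule sum.swap)
  also have "\<dots> \<le> (\<Sum>m<n. real (4 * m + 10) * d m)"
  proof (rule sum_mono)
    fix m
    have "(\<Sum>i<n. if m \<le> i \<and> i \<le> m + 3 then real (i + 1) * d m else 0)
       = (\<Sum>i\<in>{i. i < n \<and> m \<le> i \<and> i \<le> m + 3}. real (i + 1) * d m)"
      by (simp add: sum.If_cases lessThan_def Int_def)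
    also have "\<dots> \<le> (\<Sum>i\<in>{m..m + 3}. real (i + 1) * d m)"
      using d by (intro sum_mono2) auto
    also have "\<dots> = real (4 * m + 10) * d m"
      by (simp add: sum_distrib_right[symmetric] numeral_3_eq_3 algebra_simps)
    finally show "(\<Sum>i<n. if m \<le> i \<and> i \<le> m + 3 then real (i + 1) * d m else 0) \<le> real (4 * m + 10) * d m" .
  qed
  finally show ?thesis .
qed

text \<open>Summing the two terms of \<open>sum_edges_with_top_label_le\<close> over the \<open>i + 1\<close> labels of every block gives the weights
  \<open>(i + 1) + (4 i + 10) = 5 i + 11\<close>, after the factor \<open>4 ^ (q - 1) \<ge> 1\<close> is also granted to the first term.\<close>

lemma finite_edge_sum_le_drops:
  assumes van: "vanishes_at_infinity f" and q: "1 \<le> q" and F: "F \<subseteq> edges" "finite F"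
  obtains n where "(\<Sum>e\<in>F. edge_diff (spiral_rearrangement f) e powr q)
    \<le> 4 powr (q - 1) * (\<Sum>i<n. real (5 * i + 11) * block_drop f i powr q)"
proof -
  let ?g = "\<lambda>e. edge_diff (spiral_rearrangement f) e powr q"
  obtain n where n: "\<And>e. e \<in> F \<Longrightarrow> top_label e < n"
    using F(2) finite_nat_set_iff_bounded[of "top_label ` F"] by auto
  have top: "top_label ` F \<subseteq> {1<..breakpoint n}"
  proof
    fix l assume "l \<in> top_label ` F"
    then obtain e where e: "e \<in> F" "l = top_label e" by blast
    obtain z w where zw: "e = {z, w}" "adjacent z w" "spiral_label z < spiral_label w" 
      using e F edge_orient by blast
    then have "1 < l" using e(2) spiral_label_ge_1[of z] by (simp add: top_label_eq)
    then show "l \<in> {1<..breakpoint n}" using n[OF e(1)] e(2) breakpoint_ge[of n] by simp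
  qed
  define d where "d i = block_drop f i powr q" for i
  define c :: real where "c = 4 powr (q - 1)"
  have c: "1 \<le> c" using q by (simp add: c_def ge_one_powr_ge_zero)
  have "sum ?g F = (\<Sum>l\<in>{1<..breakpoint n}. \<Sum>e\<in>{e \<in> F. top_label e = l}. ?g e)"
    by (rule sum.group[symmetric]) (use F top in auto)
  also have "\<dots> = (\<Sum>i<n. \<Sum>l\<in>{breakpoint i<..breakpoint (Suc i)}. \<Sum>e\<in>{e \<in> F. top_label e = l}. ?g e)"
    by (rule sum_by_blocks)
  also have "\<dots> \<le> (\<Sum>i<n. \<Sum>l\<in>{breakpoint i<..breakpoint (Suc i)}. d i + c * (\<Sum>m\<in>{i - 3..i}. d m))"
    unfolding d_def c_def using sum_edges_with_top_label_le[OF van q F] by (intro sum_mono) auto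
  also have "\<dots> = (\<Sum>i<n. real (i + 1) * d i) + c * (\<Sum>i<n. real (i + 1) * (\<Sum>m\<in>{i - 3..i}. d m))"
    by (simp add: breakpoint_Suc sum.distrib sum_distrib_left algebra_simps)
  also have "\<dots> \<le> c * (\<Sum>i<n. real (i + 1) * d i) + c * (\<Sum>m<n. real (4 * m + 10) * d m)"
  proof (rule add_mono)
    have "0 \<le> (\<Sum>i<n. real (i + 1) * d i)" by (intro sum_nonneg) (simp add: d_def)
    then show "(\<Sum>i<n. real (i + 1) * d i) \<le> c * (\<Sum>i<n. real (i + 1) * d i)"
      using mult_right_mono[OF c] by fastforce
    show "c * (\<Sum>i<n. real (i + 1) * (\<Sum>m\<in>{i - 3..i}. d m)) \<le> c * (\<Sum>m<n. real (4 * m + 10) * d m)"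
      using c by (intro mult_left_mono sum_of_windows) (auto simp: d_def)
  qed
  also have "\<dots> = c * (\<Sum>i<n. real (5 * i + 11) * d i)"
    by (simp add: sum.distrib[symmetric] distrib_left[symmetric] algebra_simps)
  finally show thesis using that unfolding c_def d_def by blast
qed

lemma finite_edge_sum_le:
  assumes van: "vanishes_at_infinity f" and q: "1 \<le> q" and F: "F \<subseteq> edges" "finite F"
  obtains G where "finite G" "G \<subseteq> edges" "(\<Sum>e\<in>F. edge_diff (spiral_rearrangement f) e powr q)
    \<le> 4 powr (q + 1) * (\<Sum>e\<in>G. edge_diff f e powr q)"
proof -
  obtain n where n: "(\<Sum>e\<in>F. edge_diff (spiral_rearrangement f) e powr q)
    \<le> 4 powr (q - 1) * (\<Sum>i<n. real (5 * i + 11) * block_drop f i powr q)"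
    using finite_edge_sum_le_drops[OF assms] .
  obtain G where G: "finite G" "G \<subseteq> edges"
    "(\<Sum>i<n. real (5 * i + 11) * block_drop f i powr q) \<le> 16 * (\<Sum>e\<in>G. edge_diff f e powr q)"
    using weighted_drops_le[OF van q] .
  note n
  also have "4 powr (q - 1) * (\<Sum>i<n. real (5 * i + 11) * block_drop f i powr q)
    \<le> 4 powr (q - 1) * (16 * (\<Sum>e\<in>G. edge_diff f e powr q))"
    by (intro mult_left_mono G) simp
  also have "\<dots> = 4 powr (q + 1) * (\<Sum>e\<in>G. edge_diff f e powr q)"
    by (simp add: powr_add powr_diff)
  finally show thesis using that G by blast
qed

section \<open>The gradient norms\<close>

text \<open>A positive drop is spanned by at least one edge of \<open>f\<close>, and a difference of the rearrangement is a sum of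
  at most four drops.\<close>

lemma grad_norm_infinity_le:
  assumes van: "vanishes_at_infinity f"
  shows "grad_norm \<infinity> (spiral_rearrangement f) \<le> 4 * grad_norm \<infinity> f"
proof -
  define N where "N = grad_norm \<infinity> f"
  have drop: "ennreal (block_drop f i) \<le> N" for i
  proof (cases "0 < block_drop f i")
    case True
    obtain E where E: "finite E" "E \<subseteq> edges" "5 * i + 11 \<le> 16 * card E" "\<And>e. e \<in> E \<Longrightarrow> spans_block f i e"
      using many_spanning_edges[OF van True] by blast
    then obtain e where e: "e \<in> E" by fastforce
    have "ennreal (block_drop f i) \<le> ennreal (edge_diff f e)"
      by (intro ennreal_leI block_drop_le_edge_diff[OF van] E(4) e)
    also have "\<dots> \<le> N" unfolding N_def grad_norm_def using E(2) e by (auto intro: SUP_upper)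
    finally show ?thesis .
  qed (simp add: ennreal_neg)
  have "ennreal (edge_diff (spiral_rearrangement f) e) \<le> 4 * N" if e: "e \<in> edges" for e
  proof -
    obtain z w where zw: "e = {z, w}" "adjacent z w" "spiral_label z < spiral_label w" 
      using edge_orient[OF e] .
    define l where "l = nat (spiral_label w)"
    have l: "1 < l" "spiral_label w = int l" using zw(3) spiral_label_ge_1[of z] by (auto simp: l_def)
    define i where "i = (LEAST i. l \<le> breakpoint (Suc i))"
    have up: "l \<le> breakpoint (Suc i)"
      unfolding i_def by (rule LeastI[of _ l]) (use breakpoint_ge[of "Suc l"] in simp)
    have lo: "breakpoint i < l"
    proof (cases i)
      case (Suc j)
      then have "\<not> l \<le> breakpoint (Suc j)" unfolding i_def by (intro not_less_Least) simp
      then show ?thesis using Suc by simp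
    qed (use l in simp)
    have "edge_diff (spiral_rearrangement f) e \<le> (\<Sum>m\<in>{i - 3..i}. block_drop f m)"
      unfolding zw(1) using l up lo by (intro rearranged_edge_diff_le_drops[OF van zw(2,3)]) auto
    then have "ennreal (edge_diff (spiral_rearrangement f) e) \<le> (\<Sum>m\<in>{i - 3..i}. ennreal (block_drop f m))"
      using block_drop_nonneg[OF van] by (subst sum_ennreal) (auto intro: ennreal_leI)
    also have "\<dots> \<le> (\<Sum>m\<in>{i - 3..i}. N)" by (intro sum_mono drop)
    also have "\<dots> = of_nat (card {i - 3..i}) * N" by simp
    also have "\<dots> \<le> of_nat 4 * N" by (intro mult_right_mono of_nat_mono) auto
    finally show ?thesis by simp
  qed
  then show ?thesis unfolding N_def[symmetric] by (subst grad_norm_def) (auto intro!: SUP_least)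
qed

text \<open>The infinite sums are suprema of finite ones, so the finite comparison carries over. The case of an
  infinite right-hand side is settled separately, and otherwise the \<open>q\<close>-th root turns \<open>4 ^ (q + 1)\<close> into
  \<open>4 ^ (1 + 1 / q)\<close>.\<close>

lemma grad_norm_finite_le:
  assumes van: "vanishes_at_infinity f" and q: "1 \<le> q"
  shows "grad_norm (ennreal q) (spiral_rearrangement f) \<le> ennreal (4 powr (1 + 1 / q)) * grad_norm (ennreal q) f"
proof -
  define S where "S g = (\<Sum>\<^sub>\<infinity>e\<in>edges. ennreal (edge_diff g e powr q))" for g
  have norm: "grad_norm (ennreal q) g = (if S g = \<infinity> then \<infinity> else ennreal (enn2real (S g) powr (1 / q)))" for g
    using q by (simp add: grad_norm_def S_def Let_def)
  have SUP: "S g = (SUP F\<in>{F. finite F \<and> F \<subseteq> edges}. \<Sum>e\<in>F. ennreal (edge_diff g e powr q))" for g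
    unfolding S_def by (simp add: nonneg_infsum_complete)
  have le: "S (spiral_rearrangement f) \<le> ennreal (4 powr (q + 1)) * S f"
    unfolding SUP[of "spiral_rearrangement f"]
  proof (rule SUP_least, clarify)
    fix F assume F: "finite F" "F \<subseteq> edges"
    obtain G where G: "finite G" "G \<subseteq> edges" "(\<Sum>e\<in>F. edge_diff (spiral_rearrangement f) e powr q)
      \<le> 4 powr (q + 1) * (\<Sum>e\<in>G. edge_diff f e powr q)"
      using finite_edge_sum_le[OF van q F(2,1)] .
    have "(\<Sum>e\<in>F. ennreal (edge_diff (spiral_rearrangement f) e powr q))
      \<le> ennreal (4 powr (q + 1) * (\<Sum>e\<in>G. edge_diff f e powr q))"
      using G(3) by (simp add: sum_ennreal ennreal_leI)
    also have "\<dots> = ennreal (4 powr (q + 1)) * (\<Sum>e\<in>G. ennreal (edge_diff f e powr q))"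
      by (subst ennreal_mult) (auto simp: sum_ennreal intro: sum_nonneg)
    also have "\<dots> \<le> ennreal (4 powr (q + 1)) * S f"
      unfolding SUP[of f] using G by (intro mult_left_mono SUP_upper) auto
    finally show "(\<Sum>e\<in>F. ennreal (edge_diff (spiral_rearrangement f) e powr q)) \<le> ennreal (4 powr (q + 1)) * S f" .
  qed
  show ?thesis
  proof (cases "S f = \<infinity>")
    case True
    then show ?thesis by (simp add: norm ennreal_mult_top)
  next
    case False
    then obtain s where s: "0 \<le> s" "S f = ennreal s" by (cases "S f") auto
    have "S (spiral_rearrangement f) \<le> ennreal (4 powr (q + 1) * s)"
      using le s by (simp add: ennreal_mult)
    then obtain t where t: "0 \<le> t" "S (spiral_rearrangement f) = ennreal t" "t \<le> 4 powr (q + 1) * s"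
      using s by (cases "S (spiral_rearrangement f)") (auto simp: top_unique)
    have "t powr (1 / q) \<le> (4 powr (q + 1) * s) powr (1 / q)"
      using q t by (intro powr_mono2) auto
    also have "\<dots> = 4 powr (1 + 1 / q) * s powr (1 / q)"
      using s q by (simp add: powr_mult powr_powr add_divide_distrib)
    finally show ?thesis using s t by (simp add: norm ennreal_mult[symmetric] ennreal_leI)
  qed
qed

theorem theorem1p4:
  fixes f :: "int \<times> int \<Rightarrow> real" and p :: ennreal
  assumes "vanishes_at_infinity f" and "1 \<le> p"
  shows "grad_norm p (spiral_rearrangement f)
           \<le> ennreal (4 powr (1 + enn2real (1 / p))) * grad_norm p f"
proof (cases p)
  case (real q)
  then have q: "1 \<le> q" using assms(2) by simp
  have "1 / p = ennreal (1 / q)"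
    using q real divide_ennreal[of 1 q] by simp
  then show ?thesis using grad_norm_finite_le[OF assms(1) q] q real by simp
next
  case top
  then show ?thesis using grad_norm_infinity_le[OF assms(1)] by simp
qed

end
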